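(* If a hypersequent $G$ has a derivation in $\mathbf{HMR}$, then it has a CAN-free derivation in $\mathbf{HMR}$.
   Context: Terms. Fix a countable set of variables $x,y,\dots$. Terms (in negation normal form) are generated by $A ::= x \mid \overline{x} \mid 0 \mid 1 \mid \overline{1} \mid A+A \mid rA \mid A\sqcup A \mid A\sqcap A \mid \Diamond A$ with $r\in\mathbb{R}_{>0}$. Negation: $\overline{x}$ for $x$, $\overline{\overline{x}}=x$, $\overline{0}=0$, $\overline 1$ for $1$, $\overline{\overline{1}}=1$, $\overline{A+B}=\overline A+\overline B$, $\overline{rA}=r\overline A$, $\overline{A\sqcup B}=\overline A\sqcap\overline B$, $\overline{A\sqcap B}=\overline A\sqcup\overline B$, $\overline{\Diamond A}=\Diamond\overline A$. A weighted term is $r.A$ ($r>0$); a sequent $\vdash\Gamma$ has $\Gamma$ a finite (possibly empty) multiset of weighted terms; a hypersequent is a nonempty finite multiset of sequents $\vdash\Gamma_1\mid\cdots\mid\vdash\Gamma_n$; $G\mid\vdash\Gamma$ adds a sequent. For a finite (possibly empty) sequence $\vec r=(r_1,\dots,r_n)$ of positive reals, $\vec r.A$ is the multiset $r_1.A,\dots,r_n.A$, $\sum\vec r=r_1+\dots+r_n$, $s\vec r=(sr_1,\dots,sr_n)$; $s.\Gamma$ multiplies all weights by $s>0$; if $\Gamma=r_1.A_1,\dots,r_n.A_n$ then $\Diamond\Gamma=r_1.\Diamond A_1,\dots,r_n.\Diamond A_n$. The calculus $\mathbf{HMR}$ has the rules: INIT: $\vdash$ with no premises. W: from $G$ infer $G\mid\vdash\Gamma$.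 C: from $G\mid\vdash\Gamma\mid\vdash\Gamma$ infer $G\mid\vdash\Gamma$. S: from $G\mid\vdash\Gamma_1,\Gamma_2$ infer $G\mid\vdash\Gamma_1\mid\vdash\Gamma_2$. M: from $G\mid\vdash\Gamma_1$ and $G\mid\vdash\Gamma_2$ infer $G\mid\vdash\Gamma_1,\Gamma_2$. T: for $r>0$, from $G\mid\vdash r.\Gamma$ infer $G\mid\vdash\Gamma$. ID: if $\sum\vec r=\sum\vec s$, from $G\mid\vdash\Gamma$ infer $G\mid\vdash\Gamma,\vec r.x,\vec s.\overline{x}$ ($x$ a variable). 0: from $G\mid\vdash\Gamma$ infer $G\mid\vdash\Gamma,\vec r.0$. $+$: from $G\mid\vdash\Gamma,\vec r.A,\vec r.B$ infer $G\mid\vdash\Gamma,\vec r.(A+B)$. $\times$: from $G\mid\vdash\Gamma,(s\vec r).A$ infer $G\mid\vdash\Gamma,\vec r.(sA)$. $\sqcup$: from $G\mid\vdash\Gamma,\vec r.A\mid\vdash\Gamma,\vec r.B$ infer $G\mid\vdash\Gamma,\vec r.(A\sqcup B)$. $\sqcap$: from $G\mid\vdash\Gamma,\vec r.A$ and $G\mid\vdash\Gamma,\vec r.B$ infer $G\mid\vdash\Gamma,\vec r.(A\sqcap B)$. CAN: if $\sum\vec r=\sum\vec s$, from $G\mid\vdash\Gamma,\vec s.A,\vec r.\overline A$ infer $G\mid\vdash\Gamma$. 1: if $\sum\vec r\geq\sum\vec s$, from $G\mid\vdash\Gamma$ infer $G\mid\vdash\Gamma,\vec r.1,\vec s.\overline{1}$.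 $\Diamond$: if $\sum\vec r\geq\sum\vec s$, from the single-sequent hypersequent $\vdash\Gamma,\vec r.1,\vec s.\overline 1$ infer the single-sequent hypersequent $\vdash\Diamond\Gamma,\vec r.1,\vec s.\overline 1$. A derivation is a finite tree of rule instances whose leaves are INIT; it is CAN-free if it contains no instance of CAN. *)

theory Defs
  imports Complex_Main "HOL-Library.Multiset"
begin

typedef posreal = "{r :: real. 0 < r}" morphisms real_of_posreal Abs_posreal
  by (rule exI[of _ 1]) simp

setup_lifting type_definition_posreal

instantiation posreal :: times
begin

lift_definition times_posreal :: "posreal \<Rightarrow> posreal \<Rightarrow> posreal" is "(*)"
  by simp

instance ..

end

text \<open>
  Terms in negation normal form; \<open>NVar\<close> and \<open>NOne\<close> are the negated variables and the
  negated unit.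
\<close>

datatype trm =
    Var nat
  | NVar nat
  | Zero
  | One
  | NOne
  | Plus trm trm
  | Scale posreal trm
  | Join trm trm
  | Meet trm trm
  | Dia trm

primrec neg :: "trm \<Rightarrow> trm" where
  "neg (Var x) = NVar x"
| "neg (NVar x) = Var x"
| "neg Zero = Zero"
| "neg One = NOne"
| "neg NOne = One"
| "neg (Plus A B) = Plus (neg A) (neg B)"
| "neg (Scale r A) = Scale r (neg A)"
| "neg (Join A B) = Meet (neg A) (neg B)"
| "neg (Meet A B) = Join (neg A) (neg B)"
| "neg (Dia A) = Dia (neg A)"

type_synonym sequent = "(posreal \<times> trm) multiset"

text \<open>
  The empty multiset of this type is not a hypersequent, but it is needed as a value of the
  side context \<open>G\<close> in the rules.
\<close>

type_synonym hypersequent = "sequent multiset"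

definition is_hypersequent :: "hypersequent \<Rightarrow> bool" where
  "is_hypersequent G \<longleftrightarrow> G \<noteq> {#}"

definition weighted :: "posreal list \<Rightarrow> trm \<Rightarrow> sequent" where
  "weighted rs A = mset (map (\<lambda>r. (r, A)) rs)"

definition total :: "posreal list \<Rightarrow> real" where
  "total rs = (\<Sum>r\<leftarrow>rs. real_of_posreal r)"

definition scale_seq :: "posreal \<Rightarrow> sequent \<Rightarrow> sequent" where
  "scale_seq s \<Gamma> = image_mset (\<lambda>(r, A). (s * r, A)) \<Gamma>"

definition dia_seq :: "sequent \<Rightarrow> sequent" where
  "dia_seq \<Gamma> = image_mset (\<lambda>(r, A). (r, Dia A)) \<Gamma>"

datatype rule_name =
    R_INIT | R_W | R_C | R_S | R_M | R_T | R_ID | R_ZERO | R_PLUS | R_TIMES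
  | R_JOIN | R_MEET | R_CAN | R_ONE | R_DIA

text \<open>
  \<open>rule_inst \<rho> Hs H\<close>: the rule \<open>\<rho>\<close> has an instance with list of premises \<open>Hs\<close> and conclusion \<open>H\<close>.
  The context \<open>G\<close> may be empty, except in \<open>R_W\<close>, where \<open>G\<close> alone is the premise.
\<close>

inductive rule_inst :: "rule_name \<Rightarrow> hypersequent list \<Rightarrow> hypersequent \<Rightarrow> bool" where
  INIT: "rule_inst R_INIT [] {#{#}#}"
| W: "is_hypersequent G \<Longrightarrow> rule_inst R_W [G] (add_mset \<Gamma> G)"
| C: "rule_inst R_C [add_mset \<Gamma> (add_mset \<Gamma> G)] (add_mset \<Gamma> G)"
| S: "rule_inst R_S [add_mset (\<Gamma>1 + \<Gamma>2) G] (add_mset \<Gamma>1 (add_mset \<Gamma>2 G))"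
| M: "rule_inst R_M [add_mset \<Gamma>1 G, add_mset \<Gamma>2 G] (add_mset (\<Gamma>1 + \<Gamma>2) G)"
| T: "rule_inst R_T [add_mset (scale_seq r \<Gamma>) G] (add_mset \<Gamma> G)"
| ID: "total rs = total ss \<Longrightarrow>
    rule_inst R_ID [add_mset \<Gamma> G] (add_mset (\<Gamma> + weighted rs (Var x) + weighted ss (NVar x)) G)"
| ZERO: "rule_inst R_ZERO [add_mset \<Gamma> G] (add_mset (\<Gamma> + weighted rs Zero) G)"
| PLUS: "rule_inst R_PLUS [add_mset (\<Gamma> + weighted rs A + weighted rs B) G]
    (add_mset (\<Gamma> + weighted rs (Plus A B)) G)"
| TIMES: "rule_inst R_TIMES [add_mset (\<Gamma> + weighted (map ((*) s) rs) A) G]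
    (add_mset (\<Gamma> + weighted rs (Scale s A)) G)"
| JOIN: "rule_inst R_JOIN [add_mset (\<Gamma> + weighted rs A) (add_mset (\<Gamma> + weighted rs B) G)]
    (add_mset (\<Gamma> + weighted rs (Join A B)) G)"
| MEET: "rule_inst R_MEET [add_mset (\<Gamma> + weighted rs A) G, add_mset (\<Gamma> + weighted rs B) G]
    (add_mset (\<Gamma> + weighted rs (Meet A B)) G)"
| CAN: "total rs = total ss \<Longrightarrow>
    rule_inst R_CAN [add_mset (\<Gamma> + weighted ss A + weighted rs (neg A)) G] (add_mset \<Gamma> G)"
| ONE: "total rs \<ge> total ss \<Longrightarrow>
    rule_inst R_ONE [add_mset \<Gamma> G] (add_mset (\<Gamma> + weighted rs One + weighted ss NOne) G)"
| DIA: "total rs \<ge> total ss \<Longrightarrow>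
    rule_inst R_DIA [{#\<Gamma> + weighted rs One + weighted ss NOne#}]
      {#dia_seq \<Gamma> + weighted rs One + weighted ss NOne#}"

datatype deriv = Node rule_name hypersequent "deriv list"

primrec conclusion :: "deriv \<Rightarrow> hypersequent" where
  "conclusion (Node \<rho> H ds) = H"

fun is_derivation :: "deriv \<Rightarrow> bool" where
  "is_derivation (Node \<rho> H ds) \<longleftrightarrow>
     rule_inst \<rho> (map conclusion ds) H \<and> (\<forall>d \<in> set ds. is_derivation d)"

fun can_free :: "deriv \<Rightarrow> bool" where
  "can_free (Node \<rho> H ds) \<longleftrightarrow> \<rho> \<noteq> R_CAN \<and> (\<forall>d \<in> set ds. can_free d)"

end

theory Submission
  imports Defs
begin

text \<open>
  CAN is shown to be admissible for CAN-free derivability by a soundness and completeness argument.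
  Terms are evaluated in a real vector space whose basis consists of the literals (variables, the
  unit and diamonds, up to negation), equipped with an arbitrary total linear preorder, given by
  its cone \<open>P\<close> of nonnegative vectors; joins and meets select the larger and the smaller vector. A
  hypersequent is valid if one of its sequents always has a nonnegative value. Diamonds are treated
  as opaque literals, constrained only by the conclusions of the DIA rule whose premises are
  CAN-free derivable. Then CAN is trivially sound. For completeness, the logical rules are
  semantically invertible, and a hypersequent of literals that is not CAN-free derivable is refuted
  by a total preorder that Zorn's lemma provides: since every total preorder is admitted,
  no topological separation argument is needed.
\<close>

section \<open>Extension of convex cones to total preorders\<close>

text \<open>The condition \<open>P\<close> intersected with \<open>-P\<close> being trivial is not
  imposed, so a total cone describes a preorder, in which distinct vectors may be
  equivalent.\<close>

definition cone :: "('a \<Rightarrow> real) set \<Rightarrow> bool" where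
  "cone P \<longleftrightarrow> (\<lambda>_. 0) \<in> P \<and> (\<forall>f\<in>P. \<forall>g\<in>P. (\<lambda>x. f x + g x) \<in> P) \<and>
    (\<forall>f\<in>P. \<forall>c>0. (\<lambda>x. c * f x) \<in> P)"

lemma cone_zero: "cone P \<Longrightarrow> (\<lambda>_. 0) \<in> P"
  by (simp add: cone_def)

lemma cone_add: "cone P \<Longrightarrow> f \<in> P \<Longrightarrow> g \<in> P \<Longrightarrow> (\<lambda>x. f x + g x) \<in> P"
  by (simp add: cone_def)

lemma cone_scale: "cone P \<Longrightarrow> f \<in> P \<Longrightarrow> 0 \<le> c \<Longrightarrow> (\<lambda>x. c * f x) \<in> P"
  by (cases "c = 0") (auto simp add: cone_def)

lemma cone_add_scale: "cone P \<Longrightarrow> f \<in> P \<Longrightarrow> g \<in> P \<Longrightarrow> 0 \<le> c \<Longrightarrow> (\<lambda>x. f x + c * g x) \<in> P"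
  using cone_add[of P f "\<lambda>x. c * g x"] cone_scale by blast

text \<open>This is the cone generated by \<open>P\<close> and \<open>v\<close>, against which the
  maximality of \<open>P\<close> is tested.\<close>

lemma cone_adjoin:
  assumes "cone P"
  shows "cone {f. \<exists>p\<in>P. \<exists>t\<ge>0. f = (\<lambda>x. p x + t * v x)}"
proof -
  have "\<exists>p\<in>P. \<exists>t\<ge>0. (\<lambda>_. 0) = (\<lambda>x. p x + t * v x)"
    using cone_zero[OF assms] by (intro bexI[of _ "\<lambda>_. 0"] exI[of _ 0]) auto
  moreover have "\<exists>p\<in>P. \<exists>t\<ge>0. (\<lambda>x. (p1 x + t1 * v x) + (p2 x + t2 * v x)) = (\<lambda>x. p x + t * v x)"
    if "p1 \<in> P" "p2 \<in> P" "0 \<le> t1" "0 \<le> t2" for p1 p2 t1 t2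
    using that cone_add[OF assms]
    by (intro bexI[of _ "\<lambda>x. p1 x + p2 x"] exI[of _ "t1 + t2"]) (auto simp: algebra_simps)
  moreover have "\<exists>p\<in>P. \<exists>t\<ge>0. (\<lambda>x. c * (p1 x + t1 * v x)) = (\<lambda>x. p x + t * v x)"
    if "p1 \<in> P" "0 \<le> t1" "0 < c" for p1 t1 c
    using that cone_scale[OF assms]
    by (intro bexI[of _ "\<lambda>x. c * p1 x"] exI[of _ "c * t1"]) (auto simp: algebra_simps)
  ultimately show ?thesis
    unfolding cone_def by fastforce
qed

text \<open>A cone that is maximal among those containing \<open>K\<close> and missing
  \<open>C\<close> is total. If it contained neither \<open>v\<close> nor \<open>-v\<close>,
  adjoining either one would reach \<open>C\<close>, and a positive combination of the two witnesses
  would eliminate \<open>v\<close> and lie both in the cone and in \<open>C\<close>.\<close>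

lemma total_cone_extension:
  fixes K C :: "('a \<Rightarrow> real) set"
  assumes K: "cone K" and disj: "K \<inter> C = {}"
    and C_add: "\<And>f g. f \<in> C \<Longrightarrow> g \<in> C \<Longrightarrow> (\<lambda>x. f x + g x) \<in> C"
    and C_scale: "\<And>f c. f \<in> C \<Longrightarrow> 0 < c \<Longrightarrow> (\<lambda>x. c * f x) \<in> C"
  obtains P where "cone P" "K \<subseteq> P" "P \<inter> C = {}" "\<forall>f. f \<in> P \<or> (\<lambda>x. - f x) \<in> P"
proof -
  define \<A> where "\<A> = {P. cone P \<and> K \<subseteq> P \<and> P \<inter> C = {}}"
  have "\<Union>\<C> \<in> \<A>" if "\<C> \<noteq> {}" and chain: "subset.chain \<A> \<C>" for \<C>
  proof -
    have sub: "\<C> \<subseteq> \<A>" and tot: "\<And>X Y. X \<in> \<C> \<Longrightarrow> Y \<in> \<C> \<Longrightarrow> X \<subseteq> Y \<or> Y \<subseteq> X"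
      using chain by (auto simp: subset_chain_def)
    have "(\<lambda>x. f x + g x) \<in> \<Union>\<C>" if fg: "f \<in> \<Union>\<C>" "g \<in> \<Union>\<C>" for f g
    proof -
      obtain X Y where XY: "X \<in> \<C>" "f \<in> X" "Y \<in> \<C>" "g \<in> Y" using fg by blast
      with tot obtain Z where "Z \<in> \<C>" "f \<in> Z" "g \<in> Z" by blast
      then show ?thesis using sub cone_add unfolding \<A>_def by blast
    qed
    moreover have "(\<lambda>x. c * f x) \<in> \<Union>\<C>" if "f \<in> \<Union>\<C>" "0 < c" for f c
      using that sub cone_scale[of _ f c] unfolding \<A>_def by fastforce
    moreover have "(\<lambda>_. 0) \<in> \<Union>\<C>"
      using sub \<open>\<C> \<noteq> {}\<close> cone_zero unfolding \<A>_def by blast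
    ultimately have "cone (\<Union>\<C>)" unfolding cone_def by blast
    then show ?thesis using sub \<open>\<C> \<noteq> {}\<close> unfolding \<A>_def by blast
  qed
  moreover have "K \<in> \<A>" using K disj by (simp add: \<A>_def)
  ultimately obtain P where P: "P \<in> \<A>" and max: "\<And>X. X \<in> \<A> \<Longrightarrow> P \<subseteq> X \<Longrightarrow> X = P"
    using subset_Zorn_nonempty[of \<A>] by blast
  have cP: "cone P" and KP: "K \<subseteq> P" and PC: "P \<inter> C = {}"
    using P by (auto simp: \<A>_def)
  have meets: "\<exists>p\<in>P. \<exists>t>0. (\<lambda>x. p x + t * v x) \<in> C" if "v \<notin> P" for v
  proof (rule ccontr)
    assume no: "\<not> ?thesis"
    let ?X = "{f. \<exists>p\<in>P. \<exists>t\<ge>0. f = (\<lambda>x. p x + t * v x)}"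
    have sub: "P \<subseteq> ?X"
    proof
      fix p assume "p \<in> P"
      then show "p \<in> ?X" by (intro CollectI bexI[of _ p] exI[of _ 0]) auto
    qed
    have "f \<notin> C" if f: "f \<in> ?X" for f
    proof -
      obtain p t where pt: "p \<in> P" "0 \<le> t" "f = (\<lambda>x. p x + t * v x)" using f by auto
      show ?thesis
      proof (cases "t = 0")
        case True
        then show ?thesis using pt PC by auto
      next
        case False
        then show ?thesis using pt no by force
      qed
    qed
    then have "?X \<in> \<A>" using cone_adjoin[OF cP] sub KP by (auto simp: \<A>_def)
    then have "?X = P" using max sub by blast
    moreover have "v \<in> ?X"
      using cone_zero[OF cP] by (intro CollectI bexI[of _ "\<lambda>_. 0"] exI[of _ 1]) auto
    ultimately show False using that by simp
  qed
  have "v \<in> P \<or> (\<lambda>x. - v x) \<in> P" for v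
  proof (rule ccontr)
    assume "\<not> ?thesis"
    then obtain p t p' t' where "p \<in> P" "0 < t" and c: "(\<lambda>x. p x + t * v x) \<in> C"
      and "p' \<in> P" "0 < t'" and c': "(\<lambda>x. p' x + t' * - v x) \<in> C"
      using meets[of v] meets[of "\<lambda>x. - v x"] by blast
    \<comment> \<open>The factors \<open>t'\<close> and \<open>t\<close> are chosen so that the
      multiples of \<open>v\<close> in the two elements of \<open>C\<close> cancel.\<close>
    then have "(\<lambda>x. t' * p x + t * p' x) \<in> P"
      using cone_add[OF cP] cone_scale[OF cP] by simp
    moreover have "(\<lambda>x. t' * (p x + t * v x) + t * (p' x + t' * - v x)) \<in> C"
      using C_add[OF C_scale[OF c \<open>0 < t'\<close>] C_scale[OF c' \<open>0 < t\<close>]] .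
    moreover have "(\<lambda>x. t' * (p x + t * v x) + t * (p' x + t' * - v x)) = (\<lambda>x. t' * p x + t * p' x)"
      by (simp add: algebra_simps)
    ultimately show False using PC by auto
  qed
  then show ?thesis by (intro that[OF cP KP PC] allI)
qed

section \<open>CAN-free derivability\<close>

text \<open>Working with a predicate on hypersequents gives rule induction and hides the derivation
  trees until the last step.\<close>

inductive canfree :: "hypersequent \<Rightarrow> bool" where
  rule: "rule_inst \<rho> Hs H \<Longrightarrow> \<rho> \<noteq> R_CAN \<Longrightarrow> (\<And>h. h \<in> set Hs \<Longrightarrow> canfree h) \<Longrightarrow> canfree H"

lemma canfree_imp_deriv:
  "canfree H \<Longrightarrow> \<exists>d. is_derivation d \<and> can_free d \<and> conclusion d = H"
proof (induction rule: canfree.induct)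
  case (rule \<rho> Hs H)
  then obtain f where f: "\<And>h. h \<in> set Hs \<Longrightarrow> is_derivation (f h) \<and> can_free (f h) \<and> conclusion (f h) = h"
    by metis
  then have "map conclusion (map f Hs) = Hs" by (simp add: map_idI)
  then show ?case using rule f
    by (intro exI[of _ "Node \<rho> H (map f Hs)"]) auto
qed

lemma canfree_init: "canfree {#{#}#}"
  by (rule canfree.rule[OF rule_inst.INIT]) auto

lemma canfree_weaken: "canfree G \<Longrightarrow> is_hypersequent G \<Longrightarrow> canfree (add_mset \<Gamma> G)"
  by (rule canfree.rule[OF rule_inst.W]) auto

lemma canfree_contract: "canfree (add_mset \<Gamma> (add_mset \<Gamma> G)) \<Longrightarrow> canfree (add_mset \<Gamma> G)"
  by (rule canfree.rule[OF rule_inst.C]) auto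

lemma canfree_split: "canfree (add_mset (\<Gamma>1 + \<Gamma>2) G) \<Longrightarrow> canfree (add_mset \<Gamma>1 (add_mset \<Gamma>2 G))"
  by (rule canfree.rule[OF rule_inst.S]) auto

lemma canfree_mix:
  "canfree (add_mset \<Gamma>1 G) \<Longrightarrow> canfree (add_mset \<Gamma>2 G) \<Longrightarrow> canfree (add_mset (\<Gamma>1 + \<Gamma>2) G)"
  by (rule canfree.rule[OF rule_inst.M]) auto

lemma canfree_unscale: "canfree (add_mset (scale_seq r \<Gamma>) G) \<Longrightarrow> canfree (add_mset \<Gamma> G)"
  by (rule canfree.rule[OF rule_inst.T]) auto

lemma canfree_var: "total rs = total ss \<Longrightarrow> canfree (add_mset \<Gamma> G) \<Longrightarrow>
    canfree (add_mset (\<Gamma> + weighted rs (Var x) + weighted ss (NVar x)) G)"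
  by (rule canfree.rule[OF rule_inst.ID]) auto

lemma canfree_one: "total ss \<le> total rs \<Longrightarrow> canfree (add_mset \<Gamma> G) \<Longrightarrow>
    canfree (add_mset (\<Gamma> + weighted rs One + weighted ss NOne) G)"
  by (rule canfree.rule[OF rule_inst.ONE]) auto

lemma canfree_dia: "total ss \<le> total rs \<Longrightarrow> canfree {#\<Gamma> + weighted rs One + weighted ss NOne#} \<Longrightarrow>
    canfree {#dia_seq \<Gamma> + weighted rs One + weighted ss NOne#}"
  by (rule canfree.rule[OF rule_inst.DIA]) auto

section \<open>Logical rules acting on a single weighted term\<close>

lemma weighted_single: "weighted [r] A = {#(r, A)#}"
  by (simp add: weighted_def)

lemma canfree_zero: "canfree (add_mset \<Gamma> G) \<Longrightarrow> canfree (add_mset (add_mset (r, Zero) \<Gamma>) G)"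
  using canfree.rule[OF rule_inst.ZERO[of \<Gamma> G "[r]"]] by (simp add: weighted_single)

lemma canfree_plus: "canfree (add_mset (add_mset (r, A) (add_mset (r, B) \<Gamma>)) G) \<Longrightarrow>
    canfree (add_mset (add_mset (r, Plus A B) \<Gamma>) G)"
  using canfree.rule[OF rule_inst.PLUS[of \<Gamma> "[r]" A B G]]
  by (simp add: weighted_single add_mset_commute)

lemma canfree_times: "canfree (add_mset (add_mset (s * r, A) \<Gamma>) G) \<Longrightarrow>
    canfree (add_mset (add_mset (r, Scale s A) \<Gamma>) G)"
  using canfree.rule[OF rule_inst.TIMES[of \<Gamma> s "[r]" A G]] by (simp add: weighted_single)

lemma canfree_join: "canfree (add_mset (add_mset (r, A) \<Gamma>) (add_mset (add_mset (r, B) \<Gamma>) G)) \<Longrightarrow>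
    canfree (add_mset (add_mset (r, Join A B) \<Gamma>) G)"
  using canfree.rule[OF rule_inst.JOIN[of \<Gamma> "[r]" A B G]] by (simp add: weighted_single)

lemma canfree_meet: "canfree (add_mset (add_mset (r, A) \<Gamma>) G) \<Longrightarrow>
    canfree (add_mset (add_mset (r, B) \<Gamma>) G) \<Longrightarrow>
    canfree (add_mset (add_mset (r, Meet A B) \<Gamma>) G)"
  using canfree.rule[OF rule_inst.MEET[of \<Gamma> "[r]" A G B]] by (auto simp: weighted_single)

section \<open>Arithmetic of weights and scaling of sequents\<close>

lemma real_of_posreal_pos [simp]: "0 < real_of_posreal r"
  using real_of_posreal[of r] by simp

lemma real_of_posreal_times [simp]: "real_of_posreal (r * s) = real_of_posreal r * real_of_posreal s"
  by (rule times_posreal.rep_eq)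

lemma obtain_posreal:
  assumes "0 < c" obtains r where "real_of_posreal r = c"
  using Abs_posreal_inverse[of c] assms by auto

lemma scale_seq_inverse:
  assumes "real_of_posreal r * real_of_posreal s = 1"
  shows "scale_seq r (scale_seq s \<Gamma>) = \<Gamma>"
proof -
  have "r * (s * t) = t" for t
    using assms by (simp flip: real_of_posreal_inject mult.assoc)
  then show ?thesis
    by (simp add: scale_seq_def multiset.map_comp comp_def case_prod_unfold)
qed

text \<open>The rule T removes a factor; applied with the reciprocal factor it introduces
  one.\<close>

lemma canfree_scale:
  assumes "canfree (add_mset \<Gamma> G)" shows "canfree (add_mset (scale_seq s \<Gamma>) G)"
proof -
  obtain r where "real_of_posreal r = 1 / real_of_posreal s"
    using obtain_posreal[of "1 / real_of_posreal s"] by auto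
  then have "real_of_posreal r * real_of_posreal s = 1"
    using real_of_posreal_pos[of s] by (simp del: real_of_posreal_pos)
  then have "canfree (add_mset (scale_seq r (scale_seq s \<Gamma>)) G)"
    using assms by (simp add: scale_seq_inverse)
  then show ?thesis by (rule canfree_unscale)
qed

lemma weighted_append: "weighted (rs @ ss) A = weighted rs A + weighted ss A"
  by (simp add: weighted_def)

lemma total_append: "total (rs @ ss) = total rs + total ss"
  by (simp add: total_def)

lemma total_nonneg: "0 \<le> total rs"
  by (induction rs) (auto simp: total_def intro: add_nonneg_nonneg[OF less_imp_le])

lemma total_map_times: "total (map ((*) s) rs) = real_of_posreal s * total rs"
  by (induction rs) (auto simp: total_def algebra_simps)

lemma scale_seq_union: "scale_seq s (\<Gamma> + \<Delta>) = scale_seq s \<Gamma> + scale_seq s \<Delta>"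
  by (simp add: scale_seq_def)

lemma scale_seq_weighted: "scale_seq s (weighted rs A) = weighted (map ((*) s) rs) A"
  by (simp add: scale_seq_def weighted_def comp_def flip: mset_map)

lemma dia_seq_union: "dia_seq (\<Gamma> + \<Delta>) = dia_seq \<Gamma> + dia_seq \<Delta>"
  by (simp add: dia_seq_def)

lemma dia_seq_scale: "dia_seq (scale_seq s \<Gamma>) = scale_seq s (dia_seq \<Gamma>)"
  by (simp add: dia_seq_def scale_seq_def multiset.map_comp comp_def case_prod_unfold)

section \<open>Evaluation in a totally preordered vector space\<close>

text \<open>
  Vectors are represented by the functionals that they induce on assignments \<open>\<phi>\<close> of reals to
  literals. In this representation, the value of \<open>Dia A\<close> can be specialised to that of \<open>A\<close>
  by choosing \<open>\<phi>\<close>.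
\<close>

type_synonym vec = "(trm \<Rightarrow> real) \<Rightarrow> real"

text \<open>The antisymmetrisation makes the values of a literal and of its negation opposite.\<close>

definition lit_val :: "trm \<Rightarrow> vec" where
  "lit_val L \<phi> = \<phi> L - \<phi> (neg L)"

text \<open>The tests for joins and meets are mirror images, so that a join and its negation select
  corresponding operands even when the two operands are equivalent. This makes \<open>ev_neg\<close>
  an exact equation.\<close>

primrec ev :: "vec set \<Rightarrow> trm \<Rightarrow> vec" where
  "ev P (Var x) = lit_val (Var x)"
| "ev P (NVar x) = lit_val (NVar x)"
| "ev P Zero = (\<lambda>_. 0)"
| "ev P One = lit_val One"
| "ev P NOne = lit_val NOne"
| "ev P (Plus A B) = (\<lambda>\<phi>. ev P A \<phi> + ev P B \<phi>)"
| "ev P (Scale r A) = (\<lambda>\<phi>. real_of_posreal r * ev P A \<phi>)"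
| "ev P (Join A B) = (if (\<lambda>\<phi>. ev P B \<phi> - ev P A \<phi>) \<in> P then ev P B else ev P A)"
| "ev P (Meet A B) = (if (\<lambda>\<phi>. ev P A \<phi> - ev P B \<phi>) \<in> P then ev P B else ev P A)"
| "ev P (Dia A) = lit_val (Dia A)"

definition val :: "vec set \<Rightarrow> sequent \<Rightarrow> vec" where
  "val P \<Gamma> \<phi> = (\<Sum>(r, A)\<in>#\<Gamma>. real_of_posreal r * ev P A \<phi>)"

lemma neg_neg [simp]: "neg (neg A) = A"
  by (induction A) auto

lemma ev_neg: "ev P (neg A) \<phi> = - ev P A \<phi>"
proof (induction A arbitrary: \<phi>)
  case (Plus A B)
  then show ?case by simp
next
  case (Scale r A)
  then show ?case by simp
next
  case (Join A B)
  then show ?case by (simp add: algebra_simps)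
next
  case (Meet A B)
  then show ?case by (simp add: algebra_simps)
qed (simp_all add: lit_val_def)

lemma val_empty [simp]: "val P {#} \<phi> = 0"
  by (simp add: val_def)

lemma val_add_mset [simp]: "val P (add_mset (r, A) \<Gamma>) \<phi> = real_of_posreal r * ev P A \<phi> + val P \<Gamma> \<phi>"
  by (simp add: val_def)

lemma val_union [simp]: "val P (\<Gamma> + \<Delta>) \<phi> = val P \<Gamma> \<phi> + val P \<Delta> \<phi>"
  by (simp add: val_def)

lemma val_weighted [simp]: "val P (weighted rs A) \<phi> = total rs * ev P A \<phi>"
  by (induction rs) (auto simp: weighted_def total_def algebra_simps)

lemma val_scale_seq [simp]: "val P (scale_seq s \<Gamma>) \<phi> = real_of_posreal s * val P \<Gamma> \<phi>"
  by (induction \<Gamma>) (auto simp: scale_seq_def algebra_simps)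



section \<open>Soundness\<close>

primrec md :: "trm \<Rightarrow> nat" where
  "md (Var x) = 0"
| "md (NVar x) = 0"
| "md Zero = 0"
| "md One = 0"
| "md NOne = 0"
| "md (Plus A B) = max (md A) (md B)"
| "md (Scale r A) = md A"
| "md (Join A B) = max (md A) (md B)"
| "md (Meet A B) = max (md A) (md B)"
| "md (Dia A) = Suc (md A)"

text \<open>Modal depth stratifies the diamond axioms; completeness is proved by induction on the
  bound.\<close>

definition md_le :: "nat \<Rightarrow> sequent \<Rightarrow> bool" where
  "md_le d \<Gamma> \<longleftrightarrow> (\<forall>p\<in>#\<Gamma>. md (snd p) \<le> d)"

lemma md_le_empty [simp]: "md_le d {#}"
  and md_le_add_mset [simp]: "md_le d (add_mset p \<Gamma>) \<longleftrightarrow> md (snd p) \<le> d \<and> md_le d \<Gamma>"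
  and md_le_union [simp]: "md_le d (\<Gamma> + \<Delta>) \<longleftrightarrow> md_le d \<Gamma> \<and> md_le d \<Delta>"
  by (auto simp: md_le_def)

lemma md_le_weighted [simp]: "md_le d (weighted rs A) \<longleftrightarrow> rs = [] \<or> md A \<le> d"
  by (cases rs) (auto simp: md_le_def weighted_def)

lemma md_le_scale_seq [simp]: "md_le d (scale_seq s \<Gamma>) \<longleftrightarrow> md_le d \<Gamma>"
  by (auto simp: md_le_def scale_seq_def)

lemma md_le_dia_seq_0 [simp]: "md_le 0 (dia_seq \<Gamma>) \<longleftrightarrow> \<Gamma> = {#}"
  by (induction \<Gamma>) (auto simp: md_le_def dia_seq_def)

lemma md_le_dia_seq_Suc [simp]: "md_le (Suc d) (dia_seq \<Gamma>) \<longleftrightarrow> md_le d \<Gamma>"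
  by (auto simp: md_le_def dia_seq_def)

text \<open>The values of conclusions of DIA with CAN-free derivable premises, enlarged by
  nonnegative multiples of \<open>One\<close>: this is the slack between \<open>t\<close> and the
  net weight of \<open>One\<close>. Diamonds have the same value for every preorder, so
  \<open>{}\<close> stands for an arbitrary one. For \<open>d = 0\<close> only the nonnegative
  multiples of \<open>One\<close> remain.\<close>

definition dia_cone :: "nat \<Rightarrow> vec set" where
  "dia_cone d = {f. \<exists>\<Gamma> rs ss t. md_le d (dia_seq \<Gamma>) \<and>
     canfree {#\<Gamma> + weighted rs One + weighted ss NOne#} \<and>
     0 \<le> total rs - total ss \<and> total rs - total ss \<le> t \<and>
     f = (\<lambda>\<phi>. val {} (dia_seq \<Gamma>) \<phi> + t * lit_val One \<phi>)}"

lemma dia_coneI: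
  "md_le d (dia_seq \<Gamma>) \<Longrightarrow> canfree {#\<Gamma> + weighted rs One + weighted ss NOne#} \<Longrightarrow>
   0 \<le> total rs - total ss \<Longrightarrow> total rs - total ss \<le> t \<Longrightarrow>
   (\<And>\<phi>. f \<phi> = val {} (dia_seq \<Gamma>) \<phi> + t * lit_val One \<phi>) \<Longrightarrow> f \<in> dia_cone d"
  unfolding dia_cone_def by blast

lemma one_in_dia_cone: "0 \<le> t \<Longrightarrow> (\<lambda>\<phi>. t * lit_val One \<phi>) \<in> dia_cone d"
  by (rule dia_coneI[of d "{#}" "[]" "[]" t])
    (simp_all add: dia_seq_def weighted_def total_def canfree_init)

text \<open>Sums come from mixing the two premises by M, positive multiples from rescaling a premise
  by \<open>canfree_scale\<close>.\<close>

lemma cone_dia_cone: "cone (dia_cone d)"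
proof -
  have "(\<lambda>_. 0) \<in> dia_cone d"
    using one_in_dia_cone[of 0] by simp
  moreover have "(\<lambda>\<phi>. f \<phi> + g \<phi>) \<in> dia_cone d" if f: "f \<in> dia_cone d" and g: "g \<in> dia_cone d" for f g
  proof -
    obtain \<Gamma> rs ss t where 1: "md_le d (dia_seq \<Gamma>)"
      "canfree {#\<Gamma> + weighted rs One + weighted ss NOne#}"
      "0 \<le> total rs - total ss" "total rs - total ss \<le> t"
      "f = (\<lambda>\<phi>. val {} (dia_seq \<Gamma>) \<phi> + t * lit_val One \<phi>)"
      using f by (auto simp: dia_cone_def)
    obtain \<Delta> rs' ss' t' where 2: "md_le d (dia_seq \<Delta>)"
      "canfree {#\<Delta> + weighted rs' One + weighted ss' NOne#}"
      "0 \<le> total rs' - total ss'" "total rs' - total ss' \<le> t'"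
      "g = (\<lambda>\<phi>. val {} (dia_seq \<Delta>) \<phi> + t' * lit_val One \<phi>)"
      using g by (auto simp: dia_cone_def)
    have "canfree {#(\<Gamma> + \<Delta>) + weighted (rs @ rs') One + weighted (ss @ ss') NOne#}"
      using canfree_mix[OF 1(2) 2(2)] by (simp add: weighted_append ac_simps)
    then show ?thesis using 1 2
      by (intro dia_coneI[of d "\<Gamma> + \<Delta>" "rs @ rs'" "ss @ ss'" "t + t'"])
        (simp_all add: dia_seq_union total_append algebra_simps)
  qed
  moreover have "(\<lambda>\<phi>. c * f \<phi>) \<in> dia_cone d" if f: "f \<in> dia_cone d" and c: "0 < c" for f c
  proof -
    obtain \<Gamma> rs ss t where 1: "md_le d (dia_seq \<Gamma>)"
      "canfree {#\<Gamma> + weighted rs One + weighted ss NOne#}"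
      "0 \<le> total rs - total ss" "total rs - total ss \<le> t"
      "f = (\<lambda>\<phi>. val {} (dia_seq \<Gamma>) \<phi> + t * lit_val One \<phi>)"
      using f by (auto simp: dia_cone_def)
    obtain s where s: "real_of_posreal s = c" using obtain_posreal[OF c] .
    have "canfree {#scale_seq s \<Gamma> + weighted (map ((*) s) rs) One + weighted (map ((*) s) ss) NOne#}"
      using canfree_scale[OF 1(2), of s] by (simp add: scale_seq_union scale_seq_weighted)
    moreover have "c * (total rs - total ss) \<le> c * t" "0 \<le> c * (total rs - total ss)"
      using 1 c by (auto intro: mult_left_mono)
    ultimately show ?thesis using 1 s
      by (intro dia_coneI[of d "scale_seq s \<Gamma>" "map ((*) s) rs" "map ((*) s) ss" "c * t"])
        (simp_all add: dia_seq_scale total_map_times algebra_simps)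
  qed
  ultimately show ?thesis unfolding cone_def by blast
qed

definition good :: "nat \<Rightarrow> vec set \<Rightarrow> bool" where
  "good d P \<longleftrightarrow> cone P \<and> dia_cone d \<subseteq> P \<and> (\<forall>f. f \<in> P \<or> (\<lambda>\<phi>. - f \<phi>) \<in> P)"

definition valid :: "nat \<Rightarrow> hypersequent \<Rightarrow> bool" where
  "valid d G \<longleftrightarrow> (\<forall>P. good d P \<longrightarrow> (\<exists>\<Gamma>\<in>#G. val P \<Gamma> \<in> P))"

lemma val_dia_seq_indep: "val P (dia_seq \<Gamma>) \<phi> = val {} (dia_seq \<Gamma>) \<phi>"
  by (induction \<Gamma>) (auto simp: dia_seq_def)

lemma lit_val_NOne: "lit_val NOne \<phi> = - lit_val One \<phi>"
  by (simp add: lit_val_def)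

lemma lit_val_NVar: "lit_val (NVar x) \<phi> = - lit_val (Var x) \<phi>"
  by (simp add: lit_val_def)

lemma mem_ext: "f \<in> P \<Longrightarrow> (\<And>x. g x = f x) \<Longrightarrow> g \<in> P"
  by (metis ext)

text \<open>Induction on the CAN-free derivation; the depth bound passes from conclusions to
  premises because no rule but CAN has deeper terms above. Totality of the preorder enters in S and
  in the rule for joins.\<close>

lemma canfree_sound:
  assumes "canfree G" and good: "good d P" and "\<forall>\<Gamma>\<in>#G. md_le d \<Gamma>"
  shows "\<exists>\<Gamma>\<in>#G. val P \<Gamma> \<in> P"
  using assms(1,3)
proof (induction rule: canfree.induct)
  case (rule \<rho> Hs H)
  have cP: "cone P" and KP: "dia_cone d \<subseteq> P"
    and tot: "\<And>f. f \<notin> P \<Longrightarrow> (\<lambda>\<phi>. - f \<phi>) \<in> P"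
    using good by (auto simp: good_def)
  have one: "(\<lambda>\<phi>. t * lit_val One \<phi>) \<in> P" if "0 \<le> t" for t
    using one_in_dia_cone[OF that] KP by blast
  note IH = rule.IH
  note md = rule.prems
  from rule.hyps(1) show ?case
  proof cases
    case INIT
    then show ?thesis using cone_zero[OF cP] by simp
  next
    case (W G \<Gamma>)
    then show ?thesis using IH[of G] md by auto
  next
    case (C \<Gamma> G)
    then show ?thesis using IH md by auto
  next
    case (S \<Gamma>1 \<Gamma>2 G)
    have "val P \<Gamma>1 \<in> P \<or> val P \<Gamma>2 \<in> P" if sum: "val P (\<Gamma>1 + \<Gamma>2) \<in> P"
    proof (rule disjCI)
      \<comment> \<open>By totality the opposite of the second value lies in \<open>P\<close>;
        adding it to the sum leaves the first value.\<close>
      assume "val P \<Gamma>2 \<notin> P"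
      then show "val P \<Gamma>1 \<in> P"
        by (rule mem_ext[OF cone_add[OF cP sum tot]]) simp
    qed
    then show ?thesis using S IH md by auto
  next
    case (M \<Gamma>1 G \<Gamma>2)
    have "val P (\<Gamma>1 + \<Gamma>2) \<in> P" if "val P \<Gamma>1 \<in> P" "val P \<Gamma>2 \<in> P"
      by (rule mem_ext[OF cone_add[OF cP that]]) simp
    then show ?thesis using M IH[of "add_mset \<Gamma>1 G"] IH[of "add_mset \<Gamma>2 G"] md by auto
  next
    case (T r \<Gamma> G)
    have "val P \<Gamma> \<in> P" if "val P (scale_seq r \<Gamma>) \<in> P"
      by (rule mem_ext[OF cone_scale[OF cP that, of "1 / real_of_posreal r"]])
        (use real_of_posreal_pos[of r] in \<open>simp_all add: less_imp_le del: real_of_posreal_pos\<close>)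
    then show ?thesis using T IH md by auto
  next
    case (ID rs ss \<Gamma> G x)
    have "val P (\<Gamma> + weighted rs (Var x) + weighted ss (NVar x)) \<in> P" if "val P \<Gamma> \<in> P"
      by (rule mem_ext[OF that]) (simp add: ID lit_val_NVar)
    then show ?thesis using ID IH md by auto
  next
    case (ZERO \<Gamma> G rs)
    have "val P (\<Gamma> + weighted rs Zero) \<in> P" if "val P \<Gamma> \<in> P"
      by (rule mem_ext[OF that]) simp
    then show ?thesis using ZERO IH md by auto
  next
    case (PLUS \<Gamma> rs A B G)
    have "val P (\<Gamma> + weighted rs (Plus A B)) \<in> P" if "val P (\<Gamma> + weighted rs A + weighted rs B) \<in> P"
      by (rule mem_ext[OF that]) (simp add: algebra_simps)
    then show ?thesis using PLUS IH md by auto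
  next
    case (TIMES \<Gamma> s rs A G)
    have "val P (\<Gamma> + weighted rs (Scale s A)) \<in> P" if "val P (\<Gamma> + weighted (map ((*) s) rs) A) \<in> P"
      by (rule mem_ext[OF that]) (simp add: total_map_times algebra_simps)
    then show ?thesis using TIMES IH md by auto
  next
    case (JOIN \<Gamma> rs A B G)
    have "val P (\<Gamma> + weighted rs (Join A B)) \<in> P"
      if AB: "val P (\<Gamma> + weighted rs A) \<in> P \<or> val P (\<Gamma> + weighted rs B) \<in> P"
    proof (cases "(\<lambda>\<phi>. ev P B \<phi> - ev P A \<phi>) \<in> P")
      case True
      from AB show ?thesis
      proof
        assume "val P (\<Gamma> + weighted rs A) \<in> P"
        from cone_add_scale[OF cP this True total_nonneg[of rs]] show ?thesis
          by (rule mem_ext) (simp add: True algebra_simps)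
      next
        assume "val P (\<Gamma> + weighted rs B) \<in> P"
        then show ?thesis by (rule mem_ext) (simp add: True)
      qed
    next
      case False
      from AB show ?thesis
      proof
        assume "val P (\<Gamma> + weighted rs A) \<in> P"
        then show ?thesis by (rule mem_ext) (simp add: False)
      next
        assume "val P (\<Gamma> + weighted rs B) \<in> P"
        from cone_add_scale[OF cP this tot[OF False] total_nonneg[of rs]] show ?thesis
          by (rule mem_ext) (simp add: False algebra_simps)
      qed
    qed
    then show ?thesis using JOIN IH md by auto
  next
    case (MEET \<Gamma> rs A G B)
    have "val P (\<Gamma> + weighted rs (Meet A B)) \<in> P"
      if A: "val P (\<Gamma> + weighted rs A) \<in> P" and B: "val P (\<Gamma> + weighted rs B) \<in> P"
    proof (cases "(\<lambda>\<phi>. ev P A \<phi> - ev P B \<phi>) \<in> P")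
      case True
      show ?thesis by (rule mem_ext[OF B]) (simp add: True)
    next
      case False
      show ?thesis by (rule mem_ext[OF A]) (simp add: False)
    qed
    then show ?thesis using MEET md
      IH[of "add_mset (\<Gamma> + weighted rs A) G"] IH[of "add_mset (\<Gamma> + weighted rs B) G"] by auto
  next
    case (CAN rs ss \<Gamma> A G)
    then show ?thesis using rule.hyps by simp
  next
    case (ONE rs ss \<Gamma> G)
    have "val P (\<Gamma> + weighted rs One + weighted ss NOne) \<in> P" if "val P \<Gamma> \<in> P"
      by (rule mem_ext[OF cone_add[OF cP that one[of "total rs - total ss"]]])
        (simp_all add: ONE lit_val_NOne algebra_simps)
    then show ?thesis using ONE IH md by auto
  next
    case (DIA rs ss \<Gamma>)
    \<comment> \<open>The premise enters only through its CAN-free derivability, which is what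
      \<open>dia_cone\<close> asks for; there is no need to relate the value of a diamond to that of
      its body.\<close>
    have "val P (dia_seq \<Gamma> + weighted rs One + weighted ss NOne) \<in> dia_cone d"
      by (rule dia_coneI[of d \<Gamma> rs ss "total rs - total ss"])
        (use DIA md rule.hyps in
          \<open>simp_all add: val_dia_seq_indep[of P] lit_val_NOne algebra_simps\<close>)
    then have "val P (dia_seq \<Gamma> + weighted rs One + weighted ss NOne) \<in> P" using KP by blast
    then show ?thesis unfolding DIA(3) by (rule bexI) simp
  qed
qed

section \<open>Completeness\<close>

primrec literal :: "trm \<Rightarrow> bool" where
  "literal (Var x) = True"
| "literal (NVar x) = True"
| "literal Zero = False"
| "literal One = True"
| "literal NOne = True"
| "literal (Plus A B) = False"
| "literal (Scale r A) = False"
| "literal (Join A B) = False"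
| "literal (Meet A B) = False"
| "literal (Dia A) = True"

text \<open>Connectives are counted outside diamonds only, as diamonds are literals;
  \<open>Zero\<close> counts because its rule removes it.\<close>

primrec cx :: "trm \<Rightarrow> nat" where
  "cx (Var x) = 0"
| "cx (NVar x) = 0"
| "cx Zero = 1"
| "cx One = 0"
| "cx NOne = 0"
| "cx (Plus A B) = Suc (cx A + cx B)"
| "cx (Scale r A) = Suc (cx A)"
| "cx (Join A B) = Suc (cx A + cx B)"
| "cx (Meet A B) = Suc (cx A + cx B)"
| "cx (Dia A) = 0"

definition seq_cx :: "sequent \<Rightarrow> nat" where
  "seq_cx \<Gamma> = (\<Sum>p\<in>#\<Gamma>. cx (snd p))"

text \<open>The base 3 makes the measure decrease although the rule for joins duplicates the context.\<close>

definition hyp_cx :: "hypersequent \<Rightarrow> nat" where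
  "hyp_cx G = (\<Sum>\<Gamma>\<in>#G. 3 ^ seq_cx \<Gamma>)"

lemma seq_cx_add_mset [simp]: "seq_cx (add_mset (r, A) \<Gamma>) = cx A + seq_cx \<Gamma>"
  by (simp add: seq_cx_def)

lemma hyp_cx_add_mset [simp]: "hyp_cx (add_mset \<Gamma> G) = 3 ^ seq_cx \<Gamma> + hyp_cx G"
  by (simp add: hyp_cx_def)

text \<open>Read upwards, each logical rule preserves validity, since under every good preorder a
  join or meet has the value of one of its operands. Repeated decomposition therefore ends in valid
  hypersequents of literals.\<close>

lemma complete_if_literal_complete:
  assumes literal: "\<And>G. \<forall>\<Gamma>\<in>#G. \<forall>p\<in>#\<Gamma>. literal (snd p) \<Longrightarrow> \<forall>\<Gamma>\<in>#G. md_le d \<Gamma> \<Longrightarrow>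
    valid d G \<Longrightarrow> canfree G"
  shows "\<forall>\<Gamma>\<in>#G. md_le d \<Gamma> \<Longrightarrow> valid d G \<Longrightarrow> canfree G"
proof (induction G rule: measure_induct_rule[of hyp_cx])
  case (less G)
  show ?case
  proof (cases "\<forall>\<Gamma>\<in>#G. \<forall>p\<in>#\<Gamma>. literal (snd p)")
    case True
    then show ?thesis using literal less.prems by blast
  next
    case False
    then obtain \<Gamma>0 r A where mem: "\<Gamma>0 \<in># G" "(r, A) \<in># \<Gamma>0" and nl: "\<not> literal A" by force
    then obtain \<Gamma> H where G: "G = add_mset (add_mset (r, A) \<Gamma>) H"
      by (metis mset_add)
    have md: "md A \<le> d" "md_le d \<Gamma>" "\<forall>\<Gamma>\<in>#H. md_le d \<Gamma>" using less.prems G by auto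
    have val: "val P (add_mset (r, A) \<Gamma>) \<in> P \<or> (\<exists>\<Delta>\<in>#H. val P \<Delta> \<in> P)" if "good d P" for P
      using less.prems(2) that G by (auto simp: valid_def)
    show ?thesis
    proof (cases A)
      case Zero
      have "val P \<Gamma> \<in> P" if "val P (add_mset (r, A) \<Gamma>) \<in> P" for P
        by (rule mem_ext[OF that]) (simp add: Zero)
      then have "valid d (add_mset \<Gamma> H)" using val by (auto simp: valid_def)
      then have "canfree (add_mset \<Gamma> H)" using md by (intro less.IH) (auto simp: G Zero)
      then show ?thesis unfolding G Zero by (rule canfree_zero)
    next
      case (Plus B C)
      let ?\<Delta> = "add_mset (r, B) (add_mset (r, C) \<Gamma>)"
      have "val P ?\<Delta> \<in> P" if "val P (add_mset (r, A) \<Gamma>) \<in> P" for P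
        by (rule mem_ext[OF that]) (simp add: Plus algebra_simps)
      then have "valid d (add_mset ?\<Delta> H)" using val by (auto simp: valid_def)
      then have "canfree (add_mset ?\<Delta> H)" using md
        by (intro less.IH) (auto simp: G Plus add.assoc)
      then show ?thesis unfolding G Plus by (rule canfree_plus)
    next
      case (Scale s B)
      let ?\<Delta> = "add_mset (s * r, B) \<Gamma>"
      have "val P ?\<Delta> \<in> P" if "val P (add_mset (r, A) \<Gamma>) \<in> P" for P
        by (rule mem_ext[OF that]) (simp add: Scale algebra_simps)
      then have "valid d (add_mset ?\<Delta> H)" using val by (auto simp: valid_def)
      then have "canfree (add_mset ?\<Delta> H)" using md by (intro less.IH) (auto simp: G Scale)
      then show ?thesis unfolding G Scale by (rule canfree_times)
    next
      case (Join B C)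
      let ?B = "add_mset (r, B) \<Gamma>" and ?C = "add_mset (r, C) \<Gamma>"
      have "val P ?B \<in> P \<or> val P ?C \<in> P" if "val P (add_mset (r, A) \<Gamma>) \<in> P" for P
      proof (cases "(\<lambda>\<phi>. ev P C \<phi> - ev P B \<phi>) \<in> P")
        case True
        have "val P ?C \<in> P" by (rule mem_ext[OF that]) (simp add: Join True)
        then show ?thesis ..
      next
        case False
        have "val P ?B \<in> P" by (rule mem_ext[OF that]) (simp add: Join False)
        then show ?thesis ..
      qed
      then have "valid d (add_mset ?B (add_mset ?C H))" using val by (auto simp: valid_def)
      moreover have "hyp_cx (add_mset ?B (add_mset ?C H)) < hyp_cx G"
      proof -
        have "(3::nat) ^ (cx B + seq_cx \<Gamma>) \<le> 3 ^ (cx B + cx C + seq_cx \<Gamma>)"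
          "(3::nat) ^ (cx C + seq_cx \<Gamma>) \<le> 3 ^ (cx B + cx C + seq_cx \<Gamma>)"
          by (auto intro: power_increasing)
        moreover have "(0::nat) < 3 ^ (cx B + cx C + seq_cx \<Gamma>)" by simp
        ultimately have "(3::nat) ^ (cx B + seq_cx \<Gamma>) + 3 ^ (cx C + seq_cx \<Gamma>) <
            3 * 3 ^ (cx B + cx C + seq_cx \<Gamma>)"
          by linarith
        then show ?thesis by (simp add: G Join)
      qed
      ultimately have "canfree (add_mset ?B (add_mset ?C H))" using md
        by (intro less.IH) (auto simp: Join)
      then show ?thesis unfolding G Join by (rule canfree_join)
    next
      case (Meet B C)
      let ?B = "add_mset (r, B) \<Gamma>" and ?C = "add_mset (r, C) \<Gamma>"
      \<comment> \<open>The operand not selected exceeds the selected one by a vector of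
        \<open>P\<close>, by the test itself or by totality, so its sequent is nonnegative
        too.\<close>
      have BC: "val P ?B \<in> P \<and> val P ?C \<in> P" if "val P (add_mset (r, A) \<Gamma>) \<in> P" "good d P" for P
      proof (cases "(\<lambda>\<phi>. ev P B \<phi> - ev P C \<phi>) \<in> P")
        case True
        have "val P ?C \<in> P" by (rule mem_ext[OF that(1)]) (simp add: Meet True)
        moreover have "val P ?B \<in> P"
          by (rule mem_ext[OF cone_add_scale[of P _ _ "real_of_posreal r", OF _ that(1) True]])
            (use that in \<open>simp_all add: Meet True good_def algebra_simps less_imp_le\<close>)
        ultimately show ?thesis by blast
      next
        case False
        then have neg: "(\<lambda>\<phi>. - (ev P B \<phi> - ev P C \<phi>)) \<in> P" using that by (auto simp: good_def)
        have "val P ?B \<in> P" by (rule mem_ext[OF that(1)]) (simp add: Meet False)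
        moreover have "val P ?C \<in> P"
          by (rule mem_ext[OF cone_add_scale[of P _ _ "real_of_posreal r", OF _ that(1) neg]])
            (use that in \<open>simp_all add: Meet False good_def algebra_simps less_imp_le\<close>)
        ultimately show ?thesis by blast
      qed
      have "valid d (add_mset ?B H)" "valid d (add_mset ?C H)"
        using val BC by (fastforce simp: valid_def)+
      moreover have "hyp_cx (add_mset ?B H) < hyp_cx G" "hyp_cx (add_mset ?C H) < hyp_cx G"
        by (simp_all add: G Meet del: power_Suc)
      ultimately have "canfree (add_mset ?B H)" "canfree (add_mset ?C H)" using md
        by (auto intro!: less.IH simp: Meet)
      then show ?thesis unfolding G Meet by (rule canfree_meet)
    qed (use nl in auto)
  qed
qed

text \<open>Nonempty positive combinations of the components of \<open>G\<close>, formed as sequents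
  so that the rules can act on them.\<close>

inductive comb :: "hypersequent \<Rightarrow> sequent \<Rightarrow> bool" for G where
  base: "\<Gamma> \<in># G \<Longrightarrow> comb G \<Gamma>"
| add: "comb G \<Gamma> \<Longrightarrow> comb G \<Delta> \<Longrightarrow> comb G (\<Gamma> + \<Delta>)"
| scale: "comb G \<Gamma> \<Longrightarrow> comb G (scale_seq s \<Gamma>)"

text \<open>An added combination can be taken apart: S splits sums, T undoes scalings, and C absorbs
  the copies of components of \<open>G\<close>. The larger \<open>H\<close> is needed because S
  leaves one summand as an extra component while the other is treated.\<close>

lemma canfree_comb:
  assumes "comb G \<Theta>" "G \<subseteq># H" "canfree (add_mset \<Theta> H)"
  shows "canfree H"
  using assms
proof (induction arbitrary: H rule: comb.induct)
  case (base \<Gamma>)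
  then obtain H' where "H = add_mset \<Gamma> H'" by (meson mset_subset_eqD mset_add)
  then show ?case using base canfree_contract by blast
next
  case (add \<Gamma> \<Delta>)
  then have "canfree (add_mset \<Gamma> (add_mset \<Delta> H))" by (blast intro: canfree_split)
  moreover have "G \<subseteq># add_mset \<Delta> H"
    using add.prems(1) by (rule subset_mset.order_trans) simp
  ultimately have "canfree (add_mset \<Delta> H)" using add.IH(1) by blast
  then show ?case using add by blast
next
  case (scale \<Gamma> s)
  then show ?case using canfree_unscale by blast
qed

lemma comb_subset:
  assumes "comb G \<Theta>" "\<forall>\<Gamma>\<in>#G. \<forall>p\<in>#\<Gamma>. Q (snd p)"
  shows "\<forall>p\<in>#\<Theta>. Q (snd p)"
  using assms by (induction rule: comb.induct) (auto simp: scale_seq_def)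

section \<open>Literal sequents as formal linear combinations\<close>

lemma weighted_Cons: "weighted (r # rs) A = add_mset (r, A) (weighted rs A)"
  by (simp add: weighted_def)

lemma weighted_decomposition:
  obtains \<Delta> rs where "\<Gamma> = \<Delta> + weighted rs A" "\<forall>p\<in>#\<Delta>. snd p \<noteq> A"
proof -
  have "\<exists>\<Delta> rs. \<Gamma> = \<Delta> + weighted rs A \<and> (\<forall>p\<in>#\<Delta>. snd p \<noteq> A)"
  proof (induction \<Gamma>)
    case empty
    show ?case by (intro exI[of _ "{#}"] exI[of _ "[]"]) (simp add: weighted_def)
  next
    case (add p \<Gamma>)
    then obtain \<Delta> rs where IH: "\<Gamma> = \<Delta> + weighted rs A" "\<forall>p\<in>#\<Delta>. snd p \<noteq> A" by blast
    obtain r B where p: "p = (r, B)" by (cases p)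
    show ?case
    proof (cases "B = A")
      case True
      then show ?thesis using IH p
        by (intro exI[of _ \<Delta>] exI[of _ "r # rs"]) (simp add: weighted_Cons)
    next
      case False
      then show ?thesis using IH p
        by (intro exI[of _ "add_mset p \<Delta>"] exI[of _ rs]) simp
    qed
  qed
  then show ?thesis using that by blast
qed

definition var_seq :: "sequent \<Rightarrow> bool" where
  "var_seq V \<longleftrightarrow> (\<forall>p\<in>#V. \<exists>x. snd p = Var x \<or> snd p = NVar x)"

text \<open>All but \<open>V\<close> has the shape of a conclusion of DIA; \<open>V\<close> is left
  to ID.\<close>

lemma literal_decomposition:
  assumes "\<forall>p\<in>#\<Theta>. literal (snd p)"
  obtains V rs ss \<Phi> where "var_seq V" "\<Theta> = dia_seq \<Phi> + weighted rs One + weighted ss NOne + V"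
proof -
  have "\<exists>V rs ss \<Phi>. var_seq V \<and> \<Theta> = dia_seq \<Phi> + weighted rs One + weighted ss NOne + V"
    using assms
  proof (induction \<Theta>)
    case empty
    show ?case
      by (intro exI[of _ "{#}"] exI[of _ "[]"]) (simp add: weighted_def var_seq_def dia_seq_def)
  next
    case (add p \<Theta>)
    then obtain V rs ss \<Phi> where IH: "var_seq V"
      "\<Theta> = dia_seq \<Phi> + weighted rs One + weighted ss NOne + V" by auto
    obtain r B where p: "p = (r, B)" by (cases p)
    have "literal B" using add.prems p by simp
    then consider "\<exists>x. B = Var x \<or> B = NVar x" | "B = One" | "B = NOne" | A where "B = Dia A"
      by (cases B) auto
    then show ?case
    proof cases
      case 1
      then show ?thesis using IH p
        by (intro exI[of _ "add_mset p V"] exI[of _ rs] exI[of _ ss] exI[of _ \<Phi>])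
          (auto simp: var_seq_def)
    next
      case 2
      then show ?thesis using IH p
        by (intro exI[of _ V] exI[of _ "r # rs"] exI[of _ ss] exI[of _ \<Phi>])
          (auto simp: weighted_Cons)
    next
      case 3
      then show ?thesis using IH p
        by (intro exI[of _ V] exI[of _ rs] exI[of _ "r # ss"] exI[of _ \<Phi>])
          (auto simp: weighted_Cons)
    next
      case 4
      then show ?thesis using IH p
        by (intro exI[of _ V] exI[of _ rs] exI[of _ ss] exI[of _ "add_mset (r, A) \<Phi>"])
          (auto simp: dia_seq_def)
    qed
  qed
  then show ?thesis using that by blast
qed

lemma val_cong:
  "(\<And>p. p \<in># \<Gamma> \<Longrightarrow> ev P (snd p) \<phi> = ev P (snd p) \<psi>) \<Longrightarrow> val P \<Gamma> \<phi> = val P \<Gamma> \<psi>"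
  unfolding val_def by (intro arg_cong[of _ _ sum_mset] image_mset_cong) auto

lemma val_eq_0: "(\<And>p. p \<in># \<Gamma> \<Longrightarrow> ev P (snd p) \<phi> = 0) \<Longrightarrow> val P \<Gamma> \<phi> = 0"
  unfolding val_def by (intro sum_mset.neutral) auto

text \<open>If the formal sum vanishes, each variable and its negation have equal total weight, so
  ID introduces them one variable at a time.\<close>

lemma canfree_add_vars:
  assumes "var_seq V" "\<And>\<phi>. val {} V \<phi> = 0" "canfree (add_mset \<Gamma> G)"
  shows "canfree (add_mset (\<Gamma> + V) G)"
  using assms(1,2)
proof (induction V rule: measure_induct_rule[of size])
  case (less V)
  show ?case
  proof (cases "V = {#}")
    case True
    then show ?thesis using assms(3) by simp
  next
    case False
    then obtain p where p: "p \<in># V" by (meson multiset_nonemptyE)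
    then obtain x where x: "snd p = Var x \<or> snd p = NVar x" using less.prems by (auto simp: var_seq_def)
    obtain V1 rs where V1: "V = V1 + weighted rs (Var x)" "\<forall>p\<in>#V1. snd p \<noteq> Var x"
      by (rule weighted_decomposition)
    obtain V2 ss where V2: "V1 = V2 + weighted ss (NVar x)" "\<forall>p\<in>#V2. snd p \<noteq> NVar x"
      by (rule weighted_decomposition)
    have V: "V = V2 + weighted rs (Var x) + weighted ss (NVar x)" using V1 V2 by simp
    have var: "var_seq V2" using less.prems(1) unfolding V var_seq_def by auto
    \<comment> \<open>The indicator of \<open>Var x\<close> annihilates all other variables, so it
      reads off the coefficient of \<open>x\<close> in \<open>V\<close>.\<close>
    have "val {} V2 (\<lambda>L. if L = Var x then 1 else 0) = 0"
    proof (rule val_eq_0)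
      fix p assume "p \<in># V2"
      then have "snd p \<noteq> Var x" "snd p \<noteq> NVar x" "\<exists>y. snd p = Var y \<or> snd p = NVar y"
        using var V1 V2 by (auto simp: var_seq_def)
      then show "ev {} (snd p) (\<lambda>L. if L = Var x then 1 else 0) = 0"
        by (auto simp: lit_val_def)
    qed
    then have eq: "total rs = total ss"
      using less.prems(2)[of "\<lambda>L. if L = Var x then 1 else 0"]
      by (simp add: V lit_val_def)
    then have "val {} V2 \<phi> = 0" for \<phi>
      using less.prems(2)[of \<phi>] by (simp add: V lit_val_NVar)
    moreover have "size V2 < size V"
    proof -
      have "p \<notin># V2" using x V1 V2 by auto
      then have "V2 \<noteq> V" using p by auto
      then have "V2 \<subset># V" unfolding V by (auto simp: subset_mset.less_le)
      then show ?thesis by (rule mset_subset_size)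
    qed
    ultimately have "canfree (add_mset (\<Gamma> + V2) G)" using less.IH var by blast
    from canfree_var[OF eq this, of x] show ?thesis by (simp add: V ac_simps)
  qed
qed

text \<open>Assigning to each diamond the value of its body transfers linear identities between
  diamonds to the bodies. The factor 2 comes from the antisymmetrisation in
  \<open>lit_val\<close>.\<close>

lemma val_dia_seq_bodies:
  "val {} (dia_seq \<Gamma>) (\<lambda>L. case L of Dia A \<Rightarrow> ev P A \<psi> | _ \<Rightarrow> 0) = 2 * val P \<Gamma> \<psi>"
  by (induction \<Gamma>) (auto simp: dia_seq_def lit_val_def ev_neg algebra_simps)

lemma dia_seq_ev: "p \<in># dia_seq \<Gamma> \<Longrightarrow> \<exists>A. snd p = Dia A"
  by (auto simp: dia_seq_def)

text \<open>Equality with an axiom of the cone is compared on variables, on \<open>One\<close> and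
  on diamonds. The bodies \<open>\<Phi>\<close> and \<open>\<Delta>\<close> may differ as multisets
  but agree in value under every preorder, so soundness for \<open>\<Delta>\<close> makes the DIA
  premise for \<open>\<Phi>\<close> valid at smaller depth. The induction hypothesis derives it; DIA
  and ID then yield \<open>\<Theta>\<close>.\<close>

lemma canfree_if_val_in_dia_cone:
  assumes IH: "\<And>d' G. d = Suc d' \<Longrightarrow> \<forall>\<Gamma>\<in>#G. md_le d' \<Gamma> \<Longrightarrow> valid d' G \<Longrightarrow> canfree G"
    and lit: "\<forall>p\<in>#\<Theta>. literal (snd p)" and md: "md_le d \<Theta>"
    and val: "val {} \<Theta> \<in> dia_cone d"
  shows "canfree {#\<Theta>#}"
proof -
  obtain V rs ss \<Phi> where V: "var_seq V"
    and \<Theta>: "\<Theta> = dia_seq \<Phi> + weighted rs One + weighted ss NOne + V"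
    using literal_decomposition[OF lit] .
  obtain \<Delta> rs' ss' t where \<Delta>: "md_le d (dia_seq \<Delta>)"
    "canfree {#\<Delta> + weighted rs' One + weighted ss' NOne#}"
    and t: "0 \<le> total rs' - total ss'" "total rs' - total ss' \<le> t"
    and "val {} \<Theta> = (\<lambda>\<phi>. val {} (dia_seq \<Delta>) \<phi> + t * lit_val One \<phi>)"
    using val by (auto simp: dia_cone_def)
  then have eq: "val {} (dia_seq \<Phi>) \<phi> + (total rs - total ss) * lit_val One \<phi> + val {} V \<phi> =
      val {} (dia_seq \<Delta>) \<phi> + t * lit_val One \<phi>" for \<phi>
    by (simp add: \<Theta> fun_eq_iff lit_val_NOne algebra_simps)
  have V0: "val {} V \<phi> = 0" for \<phi>
  proof -
    \<comment> \<open>Restricting the assignment to variables isolates \<open>V\<close>.\<close>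
    let ?\<phi> = "\<lambda>L. case L of Var x \<Rightarrow> \<phi> L | NVar x \<Rightarrow> \<phi> L | _ \<Rightarrow> 0"
    have "val {} (dia_seq \<Gamma>) ?\<phi> = 0" for \<Gamma>
      by (rule val_eq_0) (auto dest!: dia_seq_ev simp: lit_val_def)
    moreover have "val {} V ?\<phi> = val {} V \<phi>"
      using V by (intro val_cong) (fastforce simp: var_seq_def lit_val_def)
    ultimately show ?thesis using eq[of ?\<phi>] by (simp add: lit_val_def)
  qed
  have one: "total rs - total ss = t"
  proof -
    let ?\<phi> = "\<lambda>L. if L = One then 1 else 0"
    have "val {} (dia_seq \<Gamma>) ?\<phi> = 0" for \<Gamma>
      by (rule val_eq_0) (auto dest!: dia_seq_ev simp: lit_val_def)
    then show ?thesis using eq[of ?\<phi>] V0 by (simp add: lit_val_def)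
  qed
  have bodies: "val P \<Phi> \<psi> = val P \<Delta> \<psi>" for P \<psi>
    using eq[of "\<lambda>L. case L of Dia A \<Rightarrow> ev P A \<psi> | _ \<Rightarrow> 0"] V0 one
    by (simp add: val_dia_seq_bodies)
  have "canfree {#\<Phi> + weighted rs One + weighted ss NOne#}"
  proof (cases d)
    \<comment> \<open>Without diamonds the sequent follows from INIT by the rule 1.\<close>
    case 0
    then have "\<Phi> = {#}" using md \<Theta> by simp
    then show ?thesis using canfree_one[OF _ canfree_init, of ss rs] one t by simp
  next
    case (Suc d')
    have "valid d' {#\<Phi> + weighted rs One + weighted ss NOne#}"
      unfolding valid_def
    proof (intro allI impI)
      fix P assume good: "good d' P"
      have \<Delta>P: "val P (\<Delta> + weighted rs' One + weighted ss' NOne) \<in> P"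
        using canfree_sound[OF \<Delta>(2) good] \<Delta>(1) Suc by simp
      have cP: "cone P" and KP: "dia_cone d' \<subseteq> P" using good by (auto simp: good_def)
      \<comment> \<open>The slack of the cone element becomes a nonnegative multiple of
        \<open>One\<close>.\<close>
      have "(\<lambda>\<phi>. (t - (total rs' - total ss')) * lit_val One \<phi>) \<in> P"
        using one_in_dia_cone t KP by (meson diff_ge_0_iff_ge subsetD)
      from cone_add[OF cP \<Delta>P this] have "val P (\<Phi> + weighted rs One + weighted ss NOne) \<in> P"
        by (rule mem_ext) (simp add: bodies lit_val_NOne algebra_simps flip: one)
      then show "\<exists>\<Gamma>\<in>#{#\<Phi> + weighted rs One + weighted ss NOne#}. val P \<Gamma> \<in> P" by simp
    qed
    then show ?thesis using md \<Theta> Suc by (intro IH[OF Suc]) auto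
  qed
  then have "canfree {#dia_seq \<Phi> + weighted rs One + weighted ss NOne#}"
    using one t by (intro canfree_dia) auto
  from canfree_add_vars[OF V V0 this] show ?thesis by (simp add: \<Theta>)
qed

lemma val_literal_indep: "\<forall>p\<in>#\<Gamma>. literal (snd p) \<Longrightarrow> val P \<Gamma> = val Q \<Gamma>"
proof (induction \<Gamma>)
  case (add p \<Gamma>)
  obtain r A where p: "p = (r, A)" by (cases p)
  then have "ev P A = ev Q A" using add.prems by (cases A) auto
  then show ?case using add p by (simp add: fun_eq_iff)
qed (simp add: fun_eq_iff)

text \<open>If no combination of the components had its value in \<open>dia_cone d\<close>, a total
  preorder extending this cone and avoiding all combinations would refute every component. So some
  combination is CAN-free derivable by itself, and \<open>G\<close> follows by weakening and
  \<open>canfree_comb\<close>.\<close>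

lemma canfree_complete:
  "\<forall>\<Gamma>\<in>#G. md_le d \<Gamma> \<Longrightarrow> valid d G \<Longrightarrow> canfree G"
proof (induction d arbitrary: G rule: less_induct)
  case (less d)
  show ?case
  proof (rule complete_if_literal_complete[OF _ less.prems])
    fix G assume lit: "\<forall>\<Gamma>\<in>#G. \<forall>p\<in>#\<Gamma>. literal (snd p)"
      and md: "\<forall>\<Gamma>\<in>#G. md_le d \<Gamma>" and valid: "valid d G"
    let ?C = "{val {} \<Theta> |\<Theta>. comb G \<Theta>}"
    have "dia_cone d \<inter> ?C \<noteq> {}"
    proof
      assume disj: "dia_cone d \<inter> ?C = {}"
      have C_add: "(\<lambda>\<phi>. f \<phi> + g \<phi>) \<in> ?C" if fg: "f \<in> ?C" "g \<in> ?C" for f g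
      proof -
        obtain \<Gamma> \<Delta> where "comb G \<Gamma>" "f = val {} \<Gamma>" "comb G \<Delta>" "g = val {} \<Delta>" using fg by blast
        then show ?thesis
          by (intro CollectI exI[of _ "\<Gamma> + \<Delta>"]) (simp add: fun_eq_iff comb.add)
      qed
      have C_scale: "(\<lambda>\<phi>. c * f \<phi>) \<in> ?C" if f: "f \<in> ?C" and "0 < c" for f c
      proof -
        obtain \<Gamma> where "comb G \<Gamma>" "f = val {} \<Gamma>" using f by blast
        moreover obtain s where "real_of_posreal s = c" using obtain_posreal[OF \<open>0 < c\<close>] .
        ultimately show ?thesis
          by (intro CollectI exI[of _ "scale_seq s \<Gamma>"]) (simp add: fun_eq_iff comb.scale)
      qed
      obtain P where P: "cone P" "dia_cone d \<subseteq> P" "P \<inter> ?C = {}" "\<forall>f. f \<in> P \<or> (\<lambda>x. - f x) \<in> P"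
        using total_cone_extension[OF cone_dia_cone disj C_add C_scale] .
      then have "good d P" unfolding good_def by (intro conjI)
      from valid[unfolded valid_def, rule_format, OF this]
      obtain \<Gamma> where \<Gamma>: "\<Gamma> \<in># G" "val P \<Gamma> \<in> P" by (rule bexE)
      have "val {} \<Gamma> = val P \<Gamma>" using lit \<Gamma>(1) by (intro val_literal_indep) (rule bspec)
      then have "val {} \<Gamma> \<in> P" using \<Gamma>(2) by (simp only:)
      moreover have "val {} \<Gamma> \<in> ?C" using comb.base[OF \<Gamma>(1)] by (intro CollectI exI[of _ \<Gamma>] conjI refl)
      ultimately have "val {} \<Gamma> \<in> P \<inter> ?C" by (rule IntI)
      then show False unfolding P(3) by (rule emptyE)
    qed
    then obtain \<Theta> where \<Theta>: "comb G \<Theta>" "val {} \<Theta> \<in> dia_cone d" by blast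
    have "md_le d \<Theta>"
      using comb_subset[OF \<Theta>(1), of "\<lambda>A. md A \<le> d"] md by (auto simp: md_le_def)
    then have \<Theta>_canfree: "canfree {#\<Theta>#}"
      using comb_subset[OF \<Theta>(1) lit] \<Theta>(2)
    proof (intro canfree_if_val_in_dia_cone[of d])
      fix d' H assume "d = Suc d'" "\<forall>\<Gamma>\<in>#H. md_le d' \<Gamma>" "valid d' H"
      then show "canfree H" by (intro less.IH[of d']) simp_all
    qed
    \<comment> \<open>W adds one component at a time and needs a nonempty premise, so the induction
      starts from the sequent \<open>\<Theta>\<close>.\<close>
    have "canfree (K + {#\<Theta>#})" for K
    proof (induction K)
      case (add \<Gamma> K)
      then show ?case using canfree_weaken[of "K + {#\<Theta>#}" \<Gamma>] by (simp add: is_hypersequent_def add_mset_commute)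
    qed (simp add: \<Theta>_canfree)
    from this[of G] show "canfree G"
      using canfree_comb[OF \<Theta>(1) subset_mset.order_refl] by simp
  qed
qed

section \<open>Admissibility of CAN\<close>

lemma md_le_bound: "\<exists>d. md_le d \<Gamma>"
  unfolding md_le_def
  by (rule exI[of _ "Max ((\<lambda>p. md (snd p)) ` set_mset \<Gamma>)"]) (blast intro: Max_ge finite_imageI)

lemma md_le_mono: "md_le d \<Gamma> \<Longrightarrow> d \<le> d' \<Longrightarrow> md_le d' \<Gamma>"
  by (auto simp: md_le_def)

lemma md_le_bound_hypersequent: "\<exists>d. \<forall>\<Gamma>\<in>#G. md_le d \<Gamma>"
proof (induction G)
  case (add \<Gamma> G)
  then obtain d d' where "md_le d \<Gamma>" "\<forall>\<Gamma>\<in>#G. md_le d' \<Gamma>" using md_le_bound by blast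
  then show ?case
    by (intro exI[of _ "max d d'"]) (auto intro: md_le_mono)
qed simp

text \<open>The two cancelled parts have opposite values, so the premise and the conclusion of CAN
  are equivalent in every preorder; soundness and completeness do the rest.\<close>

lemma canfree_can:
  assumes "total rs = total ss" and prem: "canfree (add_mset (\<Gamma> + weighted ss A + weighted rs (neg A)) G)"
  shows "canfree (add_mset \<Gamma> G)"
proof -
  let ?\<Delta> = "\<Gamma> + weighted ss A + weighted rs (neg A)"
  \<comment> \<open>The bound is taken over the premise, so it also covers the cancelled term, which
    may be deeper than the conclusion.\<close>
  obtain d where d: "\<forall>\<Gamma>\<in>#add_mset ?\<Delta> G. md_le d \<Gamma>"
    using md_le_bound_hypersequent by blast
  have "val P \<Gamma> \<in> P" if "val P ?\<Delta> \<in> P" for P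
    by (rule mem_ext[OF that]) (simp add: ev_neg assms(1))
  then have "valid d (add_mset \<Gamma> G)"
    using canfree_sound[OF prem _ d] by (auto simp: valid_def)
  then show ?thesis using d by (intro canfree_complete[of _ d]) auto
qed

text \<open>CAN is eliminated from the leaves downwards: when an instance is reached, its premise
  already has a CAN-free derivation.\<close>

lemma derivation_imp_canfree: "is_derivation d \<Longrightarrow> canfree (conclusion d)"
proof (induction d)
  case (Node \<rho> H ds)
  then have inst: "rule_inst \<rho> (map conclusion ds) H"
    and prems: "\<And>h. h \<in> set (map conclusion ds) \<Longrightarrow> canfree h" by auto
  show ?case
  proof (cases "\<rho> = R_CAN")
    case True
    with inst prems show ?thesis by (auto elim!: rule_inst.cases intro: canfree_can)
  next
    case False
    then show ?thesis using canfree.rule[OF inst] prems by simp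
  qed
qed

theorem theorem4p12:
  fixes G :: hypersequent
  assumes "is_hypersequent G"
    and "\<exists>d. is_derivation d \<and> conclusion d = G"
  shows "\<exists>d. is_derivation d \<and> can_free d \<and> conclusion d = G"
  using assms(2) derivation_imp_canfree canfree_imp_deriv by blast

end
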